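(* For each $n\in N$ let $\mathcal{D}_n$ be a coherent set of desirable gambles on $\mathcal{X}_n$. Then their strong product $\boxtimes_{n\in N}\mathcal{D}_n$ is an independent product of the $\mathcal{D}_n$, $n\in N$; that is, $\boxtimes_{n\in N}\mathcal{D}_n$ is an independent coherent set of desirable gambles on $\mathcal{X}_N$ with $\mathrm{marg}_{\{n\}}(\boxtimes_{m\in N}\mathcal{D}_m)=\mathcal{D}_n$ for all $n\in N$.
   Context: Let $N$ be a finite non-empty index set, and for each $n\in N$ let $\mathcal{X}_n$ be a finite non-empty set. For $R\subseteq N$ let $\mathcal{X}_R:=\prod_{r\in R}\mathcal{X}_r$, with $\mathcal{X}_\emptyset$ a one-point set. Subsets of $N$ are allowed to be empty. For a finite non-empty set $\mathcal{Z}$, a gamble on $\mathcal{Z}$ is a function $\mathcal{Z}\to\mathbb{R}$; $\mathcal{G}(\mathcal{Z})$ is the linear space of all gambles on $\mathcal{Z}$. Write $f\geq g$ for pointwise inequality and $f>g$ if $f\geq g$ and $f\neq g$; $\mathcal{G}(\mathcal{Z})_{>0}:=\{f\in\mathcal{G}(\mathcal{Z}):f>0\}$. For $\mathcal{A}\subseteq\mathcal{G}(\mathcal{Z})$, $\mathrm{posi}(\mathcal{A}):=\{\sum_{k=1}^{m}\lambda_kf_k : m\geq 1,\ f_k\in\mathcal{A},\ \lambda_k>0\}$. A set of desirable gambles $\mathcal{D}\subseteq\mathcal{G}(\mathcal{Z})$ is coherent if (D1) $0\notin\mathcal{D}$; (D2) $\mathcal{G}(\mathcal{Z})_{>0}\subseteq\mathcal{D}$;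 (D3) $\mathrm{posi}(\mathcal{D})=\mathcal{D}$. A coherent set is maximal if it is not strictly included in any other coherent set of desirable gambles on $\mathcal{Z}$; $\mathbb{M}(\mathcal{Z})$ is the set of all maximal coherent sets, and $m(\mathcal{D}):=\{\mathcal{M}\in\mathbb{M}(\mathcal{Z}):\mathcal{D}\subseteq\mathcal{M}\}$. For $R\subseteq S\subseteq N$, a gamble $f$ on $\mathcal{X}_R$ is identified with its cylindrical extension $x_S\mapsto f(x_R)$ on $\mathcal{X}_S$; $\mathbb{I}_{\{x_R\}}$ denotes the indicator of $x_R\in\mathcal{X}_R$. For $O\subseteq S\subseteq N$ and $\mathcal{D}\subseteq\mathcal{G}(\mathcal{X}_S)$, $\mathrm{marg}_O(\mathcal{D}):=\mathcal{D}\cap\mathcal{G}(\mathcal{X}_O)$. For $I\subseteq S\subseteq N$ and $x_I\in\mathcal{X}_I$, $\mathcal{D}\rfloor x_I:=\{g\in\mathcal{G}(\mathcal{X}_{S\setminus I}):\mathbb{I}_{\{x_I\}}g\in\mathcal{D}\}$. A coherent set $\mathcal{D}_N$ of desirable gambles on $\mathcal{X}_N$ is independent if $\mathrm{marg}_O(\mathcal{D}_N\rfloor x_I)=\mathrm{marg}_O(\mathcal{D}_N)$ for all disjoint subsets $I,O$ of $N$ and all $x_I\in\mathcal{X}_I$. For coherent $\mathcal{D}_n\subseteq\mathcal{G}(\mathcal{X}_n)$, $n\in N$, define $$\otimes_{n\in N}\mathcal{D}_n:=\mathrm{posi}\Big(\mathcal{G}(\mathcal{X}_N)_{>0}\cup\bigcup_{n\in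 N}\mathrm{posi}\left(\{\mathbb{I}_{\{x_{N\setminus\{n\}}\}}g : g\in\mathcal{D}_n,\ x_{N\setminus\{n\}}\in\mathcal{X}_{N\setminus\{n\}}\}\right)\Big)$$ and the strong product $$\boxtimes_{n\in N}\mathcal{D}_n:=\bigcap\{\otimes_{n\in N}\mathcal{M}_n : \mathcal{M}_n\in m(\mathcal{D}_n),\ n\in N\}.$$ *)

theory Defs
  imports Complex_Main "HOL-Library.FuncSet" "HOL-Library.Indicator_Function"
begin

text \<open>
  A gamble on a set is represented as a function on the whole type that vanishes off that set, so
  that gambles on \<open>Z\<close> form a linear subspace under pointwise operations and two gambles are equal
  iff they agree on \<open>Z\<close>. The possibility space for a set \<open>R\<close> of indices is \<open>Pi\<^sub>E R X\<close>, and
  \<open>restrict x R\<close> is the projection of \<open>x\<close> on it; \<open>Pi\<^sub>E {} X\<close> is a one-point set.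
\<close>

definition gambles :: "'z set \<Rightarrow> ('z \<Rightarrow> real) set" where
  "gambles Z = {f. \<forall>z. z \<notin> Z \<longrightarrow> f z = 0}"

definition pos_gambles :: "'z set \<Rightarrow> ('z \<Rightarrow> real) set" where
  "pos_gambles Z = {f \<in> gambles Z. (\<forall>z\<in>Z. 0 \<le> f z) \<and> f \<noteq> (\<lambda>_. 0)}"

definition posi :: "('z \<Rightarrow> real) set \<Rightarrow> ('z \<Rightarrow> real) set" where
  "posi A = {(\<lambda>z. \<Sum>k=1..m. c k * f k z) | (m::nat) c f.
     m \<ge> 1 \<and> (\<forall>k\<in>{1..m}. f k \<in> A \<and> 0 < c k)}"

definition coherent :: "'z set \<Rightarrow> ('z \<Rightarrow> real) set \<Rightarrow> bool" where
  "coherent Z D \<longleftrightarrow>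
     D \<subseteq> gambles Z \<and> (\<lambda>_. 0) \<notin> D \<and> pos_gambles Z \<subseteq> D \<and> posi D = D"

definition maximal_coherent :: "'z set \<Rightarrow> ('z \<Rightarrow> real) set set" where
  "maximal_coherent Z = {M. coherent Z M \<and> \<not> (\<exists>D. coherent Z D \<and> M \<subset> D)}"

definition maximal_supersets :: "'z set \<Rightarrow> ('z \<Rightarrow> real) set \<Rightarrow> ('z \<Rightarrow> real) set set" where
  "maximal_supersets Z D = {M \<in> maximal_coherent Z. D \<subseteq> M}"

text \<open>
  The identifications are made explicit: \<open>cyl X R S\<close> is cylindrical extension from \<open>Pi\<^sub>E R X\<close> to
  \<open>Pi\<^sub>E S X\<close> (for \<open>R \<subseteq> S\<close>), and \<open>single X n\<close> turns a gamble on \<open>X n\<close> into one on \<open>Pi\<^sub>E {n} X\<close>.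
\<close>

definition cyl ::
    "('i \<Rightarrow> 'a set) \<Rightarrow> 'i set \<Rightarrow> 'i set \<Rightarrow> (('i \<Rightarrow> 'a) \<Rightarrow> real) \<Rightarrow> (('i \<Rightarrow> 'a) \<Rightarrow> real)" where
  "cyl X R S f = (\<lambda>x. if x \<in> Pi\<^sub>E S X then f (restrict x R) else 0)"

definition single :: "('i \<Rightarrow> 'a set) \<Rightarrow> 'i \<Rightarrow> ('a \<Rightarrow> real) \<Rightarrow> (('i \<Rightarrow> 'a) \<Rightarrow> real)" where
  "single X n g = (\<lambda>x. if x \<in> Pi\<^sub>E {n} X then g (x n) else 0)"

text \<open>The gamble \<open>\<I>\<^bsub>{x}\<^esub> g\<close> on \<open>Pi\<^sub>E S X\<close>, for \<open>x \<in> Pi\<^sub>E I X\<close> and \<open>g\<close> a gamble on \<open>Pi\<^sub>E (S - I) X\<close>.\<close>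

definition ind_mult ::
    "('i \<Rightarrow> 'a set) \<Rightarrow> 'i set \<Rightarrow> 'i set \<Rightarrow> ('i \<Rightarrow> 'a) \<Rightarrow>
     (('i \<Rightarrow> 'a) \<Rightarrow> real) \<Rightarrow> (('i \<Rightarrow> 'a) \<Rightarrow> real)" where
  "ind_mult X S I x g = (\<lambda>y. cyl X I S (indicat_real {x}) y * cyl X (S - I) S g y)"

text \<open>In \<open>marg\<close> and \<open>conditional\<close>, \<open>S\<close> is the index set on whose product the gambles in \<open>D\<close> live.\<close>

definition marg ::
    "('i \<Rightarrow> 'a set) \<Rightarrow> 'i set \<Rightarrow> 'i set \<Rightarrow> (('i \<Rightarrow> 'a) \<Rightarrow> real) set \<Rightarrow> (('i \<Rightarrow> 'a) \<Rightarrow> real) set" where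
  "marg X S Q D = {f \<in> gambles (Pi\<^sub>E Q X). cyl X Q S f \<in> D}"

definition conditional ::
    "('i \<Rightarrow> 'a set) \<Rightarrow> 'i set \<Rightarrow> 'i set \<Rightarrow> ('i \<Rightarrow> 'a) \<Rightarrow>
     (('i \<Rightarrow> 'a) \<Rightarrow> real) set \<Rightarrow> (('i \<Rightarrow> 'a) \<Rightarrow> real) set" where
  "conditional X S I x D = {g \<in> gambles (Pi\<^sub>E (S - I) X). ind_mult X S I x g \<in> D}"

definition independent ::
    "'i set \<Rightarrow> ('i \<Rightarrow> 'a set) \<Rightarrow> (('i \<Rightarrow> 'a) \<Rightarrow> real) set \<Rightarrow> bool" where
  "independent N X D \<longleftrightarrow>
     (\<forall>I Q. I \<subseteq> N \<longrightarrow> Q \<subseteq> N \<longrightarrow> I \<inter> Q = {} \<longrightarrow>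
        (\<forall>x \<in> Pi\<^sub>E I X. marg X (N - I) Q (conditional X N I x D) = marg X N Q D))"

definition independent_product ::
    "'i set \<Rightarrow> ('i \<Rightarrow> 'a set) \<Rightarrow> ('i \<Rightarrow> ('a \<Rightarrow> real) set) \<Rightarrow> (('i \<Rightarrow> 'a) \<Rightarrow> real) set \<Rightarrow> bool" where
  "independent_product N X D E \<longleftrightarrow>
     coherent (Pi\<^sub>E N X) E \<and> independent N X E \<and>
     (\<forall>n\<in>N. marg X N {n} E = single X n ` D n)"

definition tensor_product ::
    "'i set \<Rightarrow> ('i \<Rightarrow> 'a set) \<Rightarrow> ('i \<Rightarrow> ('a \<Rightarrow> real) set) \<Rightarrow> (('i \<Rightarrow> 'a) \<Rightarrow> real) set" where
  "tensor_product N X D =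
     posi (pos_gambles (Pi\<^sub>E N X) \<union>
       (\<Union>n\<in>N. posi {ind_mult X N (N - {n}) x (single X n g) | x g.
                      g \<in> D n \<and> x \<in> Pi\<^sub>E (N - {n}) X}))"

definition strong_product ::
    "'i set \<Rightarrow> ('i \<Rightarrow> 'a set) \<Rightarrow> ('i \<Rightarrow> ('a \<Rightarrow> real) set) \<Rightarrow> (('i \<Rightarrow> 'a) \<Rightarrow> real) set" where
  "strong_product N X D =
     \<Inter>{tensor_product N X M | M. \<forall>n\<in>N. M n \<in> maximal_supersets (X n) (D n)}"

end

theory Submission
  imports Defs
begin

text \<open>
  An element of the tensor product is a sum of a non-negative gamble and, for each \<open>n \<in> N\<close>, a gamble
  whose sections along coordinate \<open>n\<close> are zero or lie in \<open>D n\<close>, not all summands being zero. Only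
  finitely many sections occur, so coherence of \<open>D m\<close> yields a strictly positive probability mass
  function on \<open>X m\<close> under which the non-zero sections of the \<open>m\<close>-th summand have positive
  expectation. Averaging over coordinate \<open>m\<close> makes this summand non-negative and keeps the form of
  the others. Averaging over all coordinates shows that \<open>0\<close> is not in the tensor product; averaging
  over the coordinates on which a gamble does not depend yields the marginals and independence. All
  these properties survive the intersection over maximal supersets, because a coherent set is the
  intersection of its maximal coherent supersets.
\<close>

section \<open>Convex cones, \<open>posi\<close> and strict separation\<close>

text \<open>A cone here need not contain 0, since coherent sets exclude it. Where sums may have zero
  terms, 0 is adjoined explicitly with \<open>insert\<close>.\<close>

definition convex_cone :: "('z \<Rightarrow> real) set \<Rightarrow> bool" where
  "convex_cone A \<longleftrightarrow> (\<forall>f\<in>A. \<forall>g\<in>A. (\<lambda>z. f z + g z) \<in> A) \<and>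
     (\<forall>f\<in>A. \<forall>c>0. (\<lambda>z. c * f z) \<in> A)"

lemma convex_coneD:
  assumes "convex_cone A"
  shows "f \<in> A \<Longrightarrow> g \<in> A \<Longrightarrow> (\<lambda>z. f z + g z) \<in> A"
    and "f \<in> A \<Longrightarrow> c > 0 \<Longrightarrow> (\<lambda>z. c * f z) \<in> A"
  using assms by (auto simp: convex_cone_def)

lemma posiE:
  assumes "g \<in> posi A"
  obtains m :: nat and c f where "m \<ge> 1" "\<forall>k\<in>{1..m}. f k \<in> A \<and> 0 < c k"
    "g = (\<lambda>z. \<Sum>k=1..m. c k * f k z)"
  using assms unfolding posi_def by blast

lemma posi_least:
  assumes "convex_cone B" "A \<subseteq> B"
  shows "posi A \<subseteq> B"
proof
  fix g assume "g \<in> posi A"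
  then obtain m :: nat and c f where m: "m \<ge> 1" and ass: "\<forall>k\<in>{1..m}. f k \<in> A \<and> 0 < c k"
    and g: "g = (\<lambda>z. \<Sum>k=1..m. c k * f k z)"
    by (rule posiE)
  have "(\<lambda>z. \<Sum>k=1..m. c k * f k z) \<in> B"
    using m ass
  proof (induction m rule: dec_induct)
    case base
    then show ?case using assms convex_coneD(2) by fastforce
  next
    case (step k)
    have "(\<lambda>z. (\<Sum>k=1..k. c k * f k z) + c (Suc k) * f (Suc k) z) \<in> B"
      using step assms by (intro convex_coneD) auto
    then show ?case by simp
  qed
  then show "g \<in> B" using g by simp
qed

lemma posi_increasing: "A \<subseteq> posi A"
proof
  fix f assume "f \<in> A"
  then show "f \<in> posi A"
    unfolding posi_def
    by (intro CollectI exI[of _ 1] exI[of _ "\<lambda>_. 1"] exI[of _ "\<lambda>_. f"]) auto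
qed

lemma convex_cone_posi: "convex_cone (posi A)"
  unfolding convex_cone_def
proof (intro conjI ballI allI impI)
  fix g h assume gA: "g \<in> posi A" and hA: "h \<in> posi A"
  from gA obtain m :: nat and c f where m: "m \<ge> 1" and ass: "\<forall>k\<in>{1..m}. f k \<in> A \<and> 0 < c k"
    and g: "g = (\<lambda>z. \<Sum>k=1..m. c k * f k z)"
    by (rule posiE)
  from hA obtain m' :: nat and c' f' where
    m': "m' \<ge> 1" and ass': "\<forall>k\<in>{1..m'}. f' k \<in> A \<and> 0 < c' k"
    and h: "h = (\<lambda>z. \<Sum>k=1..m'. c' k * f' k z)"
    by (rule posiE)
  \<comment> \<open>The two combinations are concatenated: indices up to \<open>m\<close> come from
    the first one, later indices are shifted by \<open>m\<close> and come from the second.\<close>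
  define C where "C k = (if k \<le> m then c k else c' (k - m))" for k
  define F where "F k = (if k \<le> m then f k else f' (k - m))" for k
  have "(\<Sum>k=1..m+m'. C k * F k z) = g z + h z" for z
  proof -
    have "(\<Sum>k=1..m+m'. C k * F k z) = (\<Sum>k=1..m. C k * F k z) + (\<Sum>k=m+1..m+m'. C k * F k z)"
      by (rule sum.ub_add_nat) simp
    also have "(\<Sum>k=m+1..m+m'. C k * F k z) = (\<Sum>k=1..m'. C (k + m) * F (k + m) z)"
      using sum.shift_bounds_cl_nat_ivl[of "\<lambda>k. C k * F k z" 1 m m'] by (simp add: add.commute)
    also have "\<dots> = h z"
      unfolding h by (intro sum.cong) (auto simp: C_def F_def)
    also have "(\<Sum>k=1..m. C k * F k z) = g z"
      unfolding g by (intro sum.cong) (auto simp: C_def F_def)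
    finally show ?thesis .
  qed
  moreover have "\<forall>k\<in>{1..m+m'}. F k \<in> A \<and> 0 < C k"
  proof
    fix k assume k: "k \<in> {1..m+m'}"
    show "F k \<in> A \<and> 0 < C k"
    proof (cases "k \<le> m")
      case True then show ?thesis using k ass by (auto simp: F_def C_def)
    next
      case False
      then have "k - m \<in> {1..m'}" using k by auto
      then show ?thesis using False ass' by (auto simp: F_def C_def)
    qed
  qed
  ultimately show "(\<lambda>z. g z + h z) \<in> posi A"
    unfolding posi_def using m
    by (intro CollectI exI[of _ "m + m'"] exI[of _ C] exI[of _ F]) auto
next
  fix g and d :: real assume gA: "g \<in> posi A" and d: "0 < d"
  from gA obtain m :: nat and c f where m: "m \<ge> 1" and ass: "\<forall>k\<in>{1..m}. f k \<in> A \<and> 0 < c k"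
    and g: "g = (\<lambda>z. \<Sum>k=1..m. c k * f k z)"
    by (rule posiE)
  show "(\<lambda>z. d * g z) \<in> posi A"
    unfolding posi_def using m ass d
    by (intro CollectI exI[of _ m] exI[of _ "\<lambda>k. d * c k"] exI[of _ f])
      (auto simp: g sum_distrib_left mult.assoc)
qed

text \<open>\<open>posi\<close> yields the least convex cone above a set, so its fixed points are
  the convex cones. This turns (D3) into closure under two pointwise operations.\<close>

lemma posi_eq_iff_convex_cone: "posi D = D \<longleftrightarrow> convex_cone D"
  by (metis convex_cone_posi posi_increasing posi_least subset_antisym order_refl)

lemma coherent_iff:
  "coherent Z D \<longleftrightarrow> D \<subseteq> gambles Z \<and> (\<lambda>_. 0) \<notin> D \<and> pos_gambles Z \<subseteq> D \<and> convex_cone D"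
  by (simp add: coherent_def posi_eq_iff_convex_cone)

lemma convex_cone_insert_zero:
  assumes "convex_cone A"
  shows "convex_cone (insert (\<lambda>_. 0) A)"
  using assms by (auto simp: convex_cone_def)

lemma convex_cone_sum:
  assumes "convex_cone A" "(\<lambda>_. 0) \<in> A" "finite W" "\<And>w. w \<in> W \<Longrightarrow> g w \<in> A"
  shows "(\<lambda>z. \<Sum>w\<in>W. g w z) \<in> A"
  using assms(3,4)
proof (induction W)
  case (insert w W)
  then show ?case using convex_coneD(1)[OF assms(1), of "g w"] by auto
qed (use assms(2) in auto)

text \<open>Adding to \<open>g v\<close> a sum that is 0 or lies in \<open>A\<close> does not leave
  \<open>A\<close>. This is how an average of sections is kept away from 0 when one of the sections
  is desirable.\<close>

lemma sum_insert_zero_mem: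
  assumes "convex_cone A" "finite W" "\<And>w. w \<in> W \<Longrightarrow> g w \<in> insert (\<lambda>_. 0) A"
    and "v \<in> W" "g v \<in> A"
  shows "(\<lambda>z. \<Sum>w\<in>W. g w z) \<in> A"
proof -
  have "(\<lambda>z. \<Sum>w\<in>W-{v}. g w z) \<in> insert (\<lambda>_. 0) A"
    using assms by (intro convex_cone_sum convex_cone_insert_zero) auto
  then have "(\<lambda>z. g v z + (\<Sum>w\<in>W-{v}. g w z)) \<in> A"
  proof
    assume "(\<lambda>z. \<Sum>w\<in>W-{v}. g w z) = (\<lambda>_. 0)"
    from fun_cong[OF this] show ?thesis using assms(5) by simp
  qed (use assms convex_coneD(1) in blast)
  then show ?thesis using assms(2,4) by (simp add: sum.remove)
qed

text \<open>Gordan's alternative, by Fourier-Motzkin elimination of one coordinate at a time.\<close>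

lemma strictly_positive_functional:
  assumes "finite Z" "finite A" "A \<subseteq> D" "convex_cone D" "(\<lambda>_. 0) \<notin> D"
    and "\<And>a z. a \<in> A \<Longrightarrow> z \<notin> Z \<Longrightarrow> a z = 0"
  shows "\<exists>p. \<forall>a\<in>A. (\<Sum>z\<in>Z. p z * a z) > (0::real)"
  using assms(1,2,3,6)
proof (induction Z arbitrary: A)
  case empty
  \<comment> \<open>Over no points at all every member of \<open>A\<close> would be the zero gamble,
    which \<open>D\<close> excludes.\<close>
  have "a = (\<lambda>_. 0)" if "a \<in> A" for a using that empty by auto
  then have "A = {}" using empty assms(5) by blast
  then show ?case by simp
next
  case (insert y Z)
  define L where "L = {a \<in> A. a y < 0}"
  define U where "U = {a \<in> A. a y > 0}"
  \<comment> \<open>For \<open>a\<close> in \<open>U\<close> and \<open>b\<close> in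
    \<open>L\<close> both coefficients are positive, so the combination stays in \<open>D\<close>;
    it vanishes at \<open>y\<close>, which eliminates that coordinate.\<close>
  define comb where "comb a b = (\<lambda>z. a y * b z + (- b y) * a z)" for a b :: "'a \<Rightarrow> real"
  define A' where "A' = {a \<in> A. a y = 0} \<union> (\<lambda>(a, b). comb a b) ` (U \<times> L)"
  have fin: "finite L" "finite U" using insert by (auto simp: L_def U_def)
  have "finite A'" using fin insert by (simp add: A'_def)
  moreover have "comb a b \<in> D" if "a \<in> U" "b \<in> L" for a b
  proof -
    have "(\<lambda>z. a y * b z) \<in> D" "(\<lambda>z. (- b y) * a z) \<in> D"
      using that insert.prems(2) by (intro convex_coneD(2)[OF assms(4)]; auto simp: U_def L_def)+
    then show ?thesis unfolding comb_def by (rule convex_coneD(1)[OF assms(4)])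
  qed
  then have "A' \<subseteq> D" using insert.prems(2) by (auto simp: A'_def)
  moreover have "a z = 0" if "a \<in> A'" "z \<notin> Z" for a z
  proof -
    have zero: "b z = 0" if "b \<in> A" "z \<noteq> y" for b using that \<open>z \<notin> Z\<close> insert.prems(3) by auto
    have "comb b c z = 0" if "b \<in> U" "c \<in> L" "z \<noteq> y" for b c
      using that zero[of b] zero[of c] unfolding comb_def U_def L_def by simp
    moreover have "comb b c y = 0" for b c by (simp add: comb_def)
    ultimately have U_L: "comb b c z = 0" if "b \<in> U" "c \<in> L" for b c
      using that by (cases "z = y") auto
    consider "a \<in> A" "a y = 0" | b c where "b \<in> U" "c \<in> L" "a = comb b c"
      using \<open>a \<in> A'\<close> by (auto simp: A'_def)
    then show ?thesis
    proof cases
      case 1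
      then show ?thesis using zero[of a] by (cases "z = y") auto
    qed (simp add: U_L)
  qed
  ultimately obtain p where p: "\<And>a. a \<in> A' \<Longrightarrow> (\<Sum>z\<in>Z. p z * a z) > 0"
    using insert.IH[of A'] by blast
  define s where "s a = (\<Sum>z\<in>Z. p z * a z)" for a :: "'a \<Rightarrow> real"
  \<comment> \<open>A weight \<open>t\<close> at \<open>y\<close> must exceed
    \<open>- s a / a y\<close> for \<open>a\<close> in \<open>U\<close> and stay below
    \<open>s b / (- b y)\<close> for \<open>b\<close> in \<open>L\<close>. Positivity on
    \<open>comb a b\<close> says that each lower bound is below each upper bound.\<close>
  have sep: "- s a / a y < s b / (- b y)" if "a \<in> U" "b \<in> L" for a b
  proof -
    have "s (comb a b) > 0" using p that by (auto simp: A'_def s_def)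
    moreover have "s (comb a b) = a y * s b + (- b y) * s a"
      unfolding s_def comb_def sum_distrib_left sum.distrib[symmetric]
      by (intro sum.cong) (auto simp: algebra_simps)
    ultimately show ?thesis using that by (auto simp: U_def L_def field_simps)
  qed
  obtain t where t: "\<And>a. a \<in> U \<Longrightarrow> - s a / a y < t" "\<And>b. b \<in> L \<Longrightarrow> t < s b / (- b y)"
  proof -
    define u where "u a = - s a / a y" for a
    define l where "l b = s b / (- b y)" for b
    have sep': "u a < l b" if "a \<in> U" "b \<in> L" for a b using sep that by (simp add: u_def l_def)
    have "\<exists>t. (\<forall>a\<in>U. u a < t) \<and> (\<forall>b\<in>L. t < l b)"
    \<comment> \<open>\<open>Max\<close> and \<open>Min\<close> are only meaningful on non-empty
      sets, so a missing family of bounds is treated apart.\<close>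
    proof (cases "U = {} \<or> L = {}")
      case True
      then show ?thesis
      proof
        assume "U = {}"
        have "\<forall>b\<in>L. Min (l ` L) - 1 < l b"
        proof
          fix b assume "b \<in> L"
          then have "Min (l ` L) \<le> l b" using fin by simp
          then show "Min (l ` L) - 1 < l b" by simp
        qed
        then show ?thesis using \<open>U = {}\<close> by blast
      next
        assume "L = {}"
        have "\<forall>a\<in>U. u a < Max (u ` U) + 1"
        proof
          fix a assume "a \<in> U"
          then have "u a \<le> Max (u ` U)" using fin by simp
          then show "u a < Max (u ` U) + 1" by simp
        qed
        then show ?thesis using \<open>L = {}\<close> by blast
      qed
    next
      case False
      then have "Max (u ` U) < Min (l ` L)" using sep' fin by simp
      then obtain t where "Max (u ` U) < t" "t < Min (l ` L)" using dense by blast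
      then show ?thesis using False fin by auto
    qed
    then show ?thesis using that unfolding u_def l_def by blast
  qed
  have "(\<Sum>z\<in>insert y Z. (p(y := t)) z * a z) > 0" if "a \<in> A" for a
  proof -
    have "(\<Sum>z\<in>insert y Z. (p(y := t)) z * a z) = t * a y + s a"
      using insert.hyps by (auto simp: s_def intro!: sum.cong)
    moreover consider "a y = 0" | "a \<in> U" | "a \<in> L" 
      using \<open>a \<in> A\<close> linorder_less_linear[of "a y" 0] unfolding U_def L_def by blast
    then have "t * a y + s a > 0"
    proof cases
      case 1
      then show ?thesis using p[of a] that by (auto simp: A'_def s_def)
    next
      case 2
      then show ?thesis using t(1)[OF 2] by (auto simp: U_def field_simps)
    next
      case 3
      then show ?thesis using t(2)[OF 3] by (auto simp: L_def field_simps)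
    qed
    ultimately show ?thesis by simp
  qed
  then show ?case by blast
qed

section \<open>Maximal coherent sets\<close>

text \<open>Adjoining \<open>- f\<close> is harmless: if 0 were \<open>d - c f\<close> with
  \<open>c > 0\<close>, then \<open>f\<close> would be a positive multiple of \<open>d\<close>,
  hence in \<open>D\<close> or zero.\<close>

lemma coherent_extend:
  assumes D: "coherent Z D" and f: "f \<in> gambles Z" "f \<notin> D" "f \<noteq> (\<lambda>_. 0)"
  obtains D' where "coherent Z D'" "D \<subseteq> D'" "(\<lambda>z. - f z) \<in> D'"
proof -
  \<comment> \<open>The second disjunct contributes the ray of \<open>- f\<close> itself; requiring
    \<open>c > 0\<close> there keeps the trivial combination out.\<close>
  define D' where "D' = {(\<lambda>z. d z - c * f z) | d c. d \<in> D \<and> c \<ge> 0 \<or> d = (\<lambda>_. 0) \<and> c > 0}"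
  have cone: "convex_cone D" and D0: "(\<lambda>_. 0) \<notin> D" using D by (auto simp: coherent_iff)
  have sub: "D \<subseteq> D'"
  proof
    fix d assume "d \<in> D"
    then show "d \<in> D'" unfolding D'_def by (intro CollectI exI[of _ d] exI[of _ 0]) auto
  qed
  have "(\<lambda>z. - f z) \<in> D'" unfolding D'_def by (intro CollectI exI[of _ "\<lambda>_. 0"] exI[of _ 1]) auto
  moreover have "D' \<subseteq> gambles Z" using D f by (auto simp: D'_def coherent_iff gambles_def)
  moreover have "(\<lambda>_. 0) \<notin> D'"
  proof
    assume "(\<lambda>_. 0) \<in> D'"
    then obtain d c where dc: "d \<in> D \<and> c \<ge> 0 \<or> d = (\<lambda>_. 0) \<and> c > 0" and
      "(\<lambda>_. 0) = (\<lambda>z. d z - c * f z)" unfolding D'_def by blast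
    then have eq: "d z = c * f z" for z by (metis eq_iff_diff_eq_0)
    show False
    proof (cases "c = 0")
      case True
      then have "d = (\<lambda>_. 0)" using eq by auto
      then show False using dc True D0 by auto
    next
      case False
      then have "f = (\<lambda>z. inverse c * d z)" using eq by auto
      then show False using f dc False convex_coneD(2)[OF cone, of d "inverse c"] by auto
    qed
  qed
  moreover have "convex_cone D'"
    unfolding convex_cone_def
  proof (intro conjI ballI allI impI)
    fix g g' assume "g \<in> D'" "g' \<in> D'"
    then obtain d c d' c' where dc: "d \<in> D \<and> c \<ge> 0 \<or> d = (\<lambda>_. 0) \<and> c > 0"
      "g = (\<lambda>z. d z - c * f z)" "d' \<in> D \<and> c' \<ge> 0 \<or> d' = (\<lambda>_. 0) \<and> c' > 0"
      "g' = (\<lambda>z. d' z - c' * f z)"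
      unfolding D'_def by blast
    then show "(\<lambda>z. g z + g' z) \<in> D'"
      unfolding D'_def using convex_coneD(1)[OF cone, of d d']
      by (intro CollectI exI[of _ "\<lambda>z. d z + d' z"] exI[of _ "c + c'"]) (auto simp: algebra_simps)
  next
    fix g and e :: real assume "g \<in> D'" "e > 0"
    then obtain d c where dc: "d \<in> D \<and> c \<ge> 0 \<or> d = (\<lambda>_. 0) \<and> c > 0" "g = (\<lambda>z. d z - c * f z)"
      unfolding D'_def by blast
    then show "(\<lambda>z. e * g z) \<in> D'"
      unfolding D'_def using convex_coneD(2)[OF cone, of d e] \<open>e > 0\<close>
      by (intro CollectI exI[of _ "\<lambda>z. e * d z"] exI[of _ "e * c"]) (auto simp: algebra_simps)
  qed
  moreover have "pos_gambles Z \<subseteq> D'" using D sub by (auto simp: coherent_iff)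
  ultimately show thesis using that sub coherent_iff by blast
qed

text \<open>Zorn's lemma on the coherent supersets of \<open>D\<close>. The union of a chain is
  closed under addition because any two of its gambles lie in a common member.\<close>

lemma maximal_supersets_nonempty:
  assumes "coherent Z D"
  obtains M where "M \<in> maximal_supersets Z D"
proof -
  define S where "S = {C. coherent Z C \<and> D \<subseteq> C}"
  have "\<exists>M\<in>S. \<forall>C\<in>S. M \<subseteq> C \<longrightarrow> C = M"
  proof (rule subset_Zorn_nonempty)
    show "S \<noteq> {}" using assms by (auto simp: S_def)
    fix C assume C: "C \<noteq> {}" "subset.chain S C"
    then have CS: "C \<subseteq> S" and lin: "\<And>A B. A \<in> C \<Longrightarrow> B \<in> C \<Longrightarrow> A \<subseteq> B \<or> B \<subseteq> A"
      by (auto simp: subset_chain_def)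
    have coh: "coherent Z A" "D \<subseteq> A" if "A \<in> C" for A using that CS by (auto simp: S_def)
    obtain A0 where "A0 \<in> C" using C by blast
    have "convex_cone (\<Union>C)"
      unfolding convex_cone_def
    proof (intro conjI ballI allI impI)
      fix f g assume "f \<in> \<Union>C" "g \<in> \<Union>C"
      then obtain A where "A \<in> C" "f \<in> A" "g \<in> A" using lin by blast
      then show "(\<lambda>z. f z + g z) \<in> \<Union>C" using coh convex_coneD(1) coherent_iff by blast
    next
      fix f and c :: real assume "f \<in> \<Union>C" "c > 0"
      then show "(\<lambda>z. c * f z) \<in> \<Union>C" using coh convex_coneD(2) coherent_iff by blast
    qed
    then show "\<Union>C \<in> S" using coh \<open>A0 \<in> C\<close> by (auto simp: S_def coherent_iff)
  qed
  then obtain M where "M \<in> S" "\<forall>C\<in>S. M \<subseteq> C \<longrightarrow> C = M" by blast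
  \<comment> \<open>A coherent set above \<open>M\<close> also contains \<open>D\<close>, so
    maximality within \<open>S\<close> is maximality among all coherent sets.\<close>
  then have "M \<in> maximal_supersets Z D"
    unfolding maximal_supersets_def maximal_coherent_def S_def by blast
  then show thesis by (rule that)
qed

text \<open>If \<open>f\<close> is outside \<open>D\<close>, some maximal superset of
  \<open>D\<close> contains \<open>- f\<close>. Were \<open>f\<close> in all of them, that one would
  contain \<open>f + (- f) = 0\<close>.\<close>

lemma Inter_maximal_supersets:
  assumes "coherent Z D"
  shows "\<Inter>(maximal_supersets Z D) = D"
proof
  show "D \<subseteq> \<Inter>(maximal_supersets Z D)" by (auto simp: maximal_supersets_def)
  show "\<Inter>(maximal_supersets Z D) \<subseteq> D"
  proof (rule subsetI, rule ccontr)
    fix f assume f: "f \<in> \<Inter>(maximal_supersets Z D)" "f \<notin> D"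
    \<comment> \<open>One maximal superset is inspected first, only to learn that \<open>f\<close>
      is a non-zero gamble, as \<open>coherent_extend\<close> demands.\<close>
    obtain M where "M \<in> maximal_supersets Z D" using maximal_supersets_nonempty[OF assms] by blast
    then have "f \<in> M" "coherent Z M" using f by (auto simp: maximal_supersets_def maximal_coherent_def)
    then have "f \<in> gambles Z" "f \<noteq> (\<lambda>_. 0)" by (auto simp: coherent_iff)
    then obtain D' where D': "coherent Z D'" "D \<subseteq> D'" "(\<lambda>z. - f z) \<in> D'"
      using coherent_extend assms f(2) by blast
    obtain M' where "M' \<in> maximal_supersets Z D'" using maximal_supersets_nonempty[OF D'(1)] by blast
    then have M': "coherent Z M'" "D' \<subseteq> M'" "M' \<in> maximal_supersets Z D"
      using D'(2) by (auto simp: maximal_supersets_def maximal_coherent_def)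
    then have "f \<in> M'" "(\<lambda>z. - f z) \<in> M'" using f(1) D'(3) by auto
    then have "(\<lambda>z. f z + - f z) \<in> M'" using M'(1) convex_coneD(1) coherent_iff by blast
    then show False using M'(1) by (simp add: coherent_iff)
  qed
qed

lemma coherent_Inter:
  assumes "F \<noteq> {}" "\<And>D. D \<in> F \<Longrightarrow> coherent Z D"
  shows "coherent Z (\<Inter>F)"
  unfolding coherent_iff
proof (intro conjI)
  show "\<Inter>F \<subseteq> gambles Z" "(\<lambda>_. 0) \<notin> \<Inter>F" "pos_gambles Z \<subseteq> \<Inter>F"
    using assms unfolding coherent_iff by blast+
  have "convex_cone D" if "D \<in> F" for D using assms(2)[OF that] by (simp add: coherent_iff)
  then show "convex_cone (\<Inter>F)" unfolding convex_cone_def by blast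
qed

lemma zero_in_gambles [simp]: "(\<lambda>_. 0) \<in> gambles Z"
  by (simp add: gambles_def)

lemma pos_gamblesI:
  "f \<in> gambles Z \<Longrightarrow> (\<And>z. 0 \<le> f z) \<Longrightarrow> f \<noteq> (\<lambda>_. 0) \<Longrightarrow> f \<in> pos_gambles Z"
  by (simp add: pos_gambles_def)

section \<open>Decompositions of gambles on the product space\<close>

locale gamble_product =
  fixes N :: "'i set" and X :: "'i \<Rightarrow> 'a set" and D :: "'i \<Rightarrow> ('a \<Rightarrow> real) set"
  assumes finite_N: "finite N"
    and finite_X: "\<And>n. n \<in> N \<Longrightarrow> finite (X n)"
    and X_ne: "\<And>n. n \<in> N \<Longrightarrow> X n \<noteq> {}"
    and coherent_D: "\<And>n. n \<in> N \<Longrightarrow> coherent (X n) (D n)"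
begin

abbreviation \<Omega> :: "('i \<Rightarrow> 'a) set" where
  "\<Omega> \<equiv> Pi\<^sub>E N X"

definition desirable_along :: "'i \<Rightarrow> (('i \<Rightarrow> 'a) \<Rightarrow> real) set" where
  "desirable_along n = {h \<in> gambles \<Omega>. \<forall>x\<in>\<Omega>. (\<lambda>z. h (x(n := z))) \<in> insert (\<lambda>_. 0) (D n)}"

definition nonneg_gambles :: "(('i \<Rightarrow> 'a) \<Rightarrow> real) set" where
  "nonneg_gambles = {q \<in> gambles \<Omega>. \<forall>x. 0 \<le> q x}"

text \<open>For \<open>R = N\<close> this is the tensor product, by
  \<open>tensor_product_eq\<close>; smaller \<open>R\<close> arise as coordinates are averaged out.
  The last condition asks for a non-trivial decomposition, not for a non-zero sum, so that the
  exclusion of 0 remains to be proved.\<close>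

definition partial_product :: "'i set \<Rightarrow> (('i \<Rightarrow> 'a) \<Rightarrow> real) set" where
  "partial_product R = {(\<lambda>x. q x + (\<Sum>n\<in>R. h n x)) | q h.
     q \<in> nonneg_gambles \<and> (\<forall>n\<in>R. h n \<in> desirable_along n) \<and>
     (q \<noteq> (\<lambda>_. 0) \<or> (\<exists>n\<in>R. h n \<noteq> (\<lambda>_. 0)))}"

text \<open>The value off \<open>\<Omega>\<close> is set to 0 explicitly, since changing coordinate
  \<open>m\<close> can move an outside point into \<open>\<Omega>\<close>.\<close>

definition average :: "'i \<Rightarrow> ('a \<Rightarrow> real) \<Rightarrow> (('i \<Rightarrow> 'a) \<Rightarrow> real) \<Rightarrow> ('i \<Rightarrow> 'a) \<Rightarrow> real" where
  "average m p f = (\<lambda>x. if x \<in> \<Omega> then \<Sum>z\<in>X m. p z * f (x(m := z)) else 0)"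

definition depends_on :: "'i set \<Rightarrow> (('i \<Rightarrow> 'a) \<Rightarrow> real) \<Rightarrow> bool" where
  "depends_on Q f \<longleftrightarrow> (\<forall>x\<in>\<Omega>. \<forall>y\<in>\<Omega>. (\<forall>i\<in>Q. x i = y i) \<longrightarrow> f x = f y)"

text \<open>Multiplication by the indicator of \<open>x\<close> for gambles already living on
  \<open>\<Omega>\<close>, whereas \<open>ind_mult\<close> starts from a gamble on the product over
  \<open>N - I\<close>. The two are matched in \<open>ind_mult_cyl\<close>.\<close>

definition slice :: "'i set \<Rightarrow> ('i \<Rightarrow> 'a) \<Rightarrow> (('i \<Rightarrow> 'a) \<Rightarrow> real) \<Rightarrow> ('i \<Rightarrow> 'a) \<Rightarrow> real" where
  "slice I x f = (\<lambda>y. if \<forall>i\<in>I. y i = x i then f y else 0)"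

lemma convex_cone_D: "n \<in> N \<Longrightarrow> convex_cone (D n)"
  and zero_notin_D: "n \<in> N \<Longrightarrow> (\<lambda>_. 0) \<notin> D n"
  and D_gambles: "n \<in> N \<Longrightarrow> D n \<subseteq> gambles (X n)"
  and pos_D: "n \<in> N \<Longrightarrow> pos_gambles (X n) \<subseteq> D n"
  using coherent_D by (auto simp: coherent_iff)

lemma finite_Omega: "finite \<Omega>"
  by (intro finite_PiE finite_N finite_X)

lemma Omega_ne: "\<Omega> \<noteq> {}"
  using X_ne by (simp add: PiE_eq_empty_iff)

lemma upd_Omega: "x \<in> \<Omega> \<Longrightarrow> n \<in> N \<Longrightarrow> x(n := z) \<in> \<Omega> \<longleftrightarrow> z \<in> X n"
  by (auto simp: PiE_iff extensional_def split: if_splits)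

lemma gamble_upd: "f \<in> gambles \<Omega> \<Longrightarrow> n \<in> N \<Longrightarrow> z \<notin> X n \<Longrightarrow> x \<in> \<Omega> \<Longrightarrow> f (x(n := z)) = 0"
  by (simp add: gambles_def upd_Omega)

lemma desirable_alongI:
  assumes "h \<in> gambles \<Omega>"
    and "\<And>x. x \<in> \<Omega> \<Longrightarrow> (\<lambda>z. h (x(n := z))) \<in> insert (\<lambda>_. 0) (D n)"
  shows "h \<in> desirable_along n"
  using assms by (simp add: desirable_along_def)

lemma desirable_alongD:
  assumes "h \<in> desirable_along n"
  shows "h \<in> gambles \<Omega>" and "x \<in> \<Omega> \<Longrightarrow> (\<lambda>z. h (x(n := z))) \<in> insert (\<lambda>_. 0) (D n)"
  using assms by (simp_all add: desirable_along_def)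

lemma zero_desirable_along: "(\<lambda>_. 0) \<in> desirable_along n"
  by (simp add: desirable_along_def)

lemma nonneg_gamblesD:
  assumes "q \<in> nonneg_gambles"
  shows "q \<in> gambles \<Omega>" and "0 \<le> q x"
  using assms by (auto simp: nonneg_gambles_def)

lemma zero_nonneg: "(\<lambda>_. 0) \<in> nonneg_gambles"
  by (simp add: nonneg_gambles_def)

lemma desirable_along_nonzeroE:
  assumes "h \<in> desirable_along n" "h \<noteq> (\<lambda>_. 0)"
  obtains x where "x \<in> \<Omega>" "(\<lambda>z. h (x(n := z))) \<in> D n"
proof -
  obtain x where x: "h x \<noteq> 0" using assms(2) by auto
  then have "x \<in> \<Omega>" using desirable_alongD(1)[OF assms(1)] by (auto simp: gambles_def)
  moreover have "(\<lambda>z. h (x(n := z))) \<noteq> (\<lambda>_. 0)" using x by (metis fun_upd_triv)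
  ultimately show thesis using that desirable_alongD(2)[OF assms(1)] by blast
qed

lemma section_nonzero:
  assumes "(\<lambda>z. h (x(n := z))) \<in> D n" "n \<in> N"
  shows "h \<noteq> (\<lambda>_. 0)"
  using assms zero_notin_D by auto

lemma convex_cone_desirable_along:
  assumes "n \<in> N"
  shows "convex_cone (desirable_along n)"
proof -
  have c: "convex_cone (insert (\<lambda>_. 0) (D n))"
    using assms by (intro convex_cone_insert_zero convex_cone_D)
  show ?thesis
    unfolding convex_cone_def
  proof (intro conjI ballI allI impI)
    fix f g assume fg: "f \<in> desirable_along n" "g \<in> desirable_along n"
    show "(\<lambda>z. f z + g z) \<in> desirable_along n"
      using fg[THEN desirable_alongD(1)] convex_coneD(1)[OF c fg[THEN desirable_alongD(2)]]
      by (intro desirable_alongI) (auto simp: gambles_def)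
  next
    fix f and e :: real assume f: "f \<in> desirable_along n" "e > 0"
    show "(\<lambda>z. e * f z) \<in> desirable_along n"
      using desirable_alongD(1)[OF f(1)] convex_coneD(2)[OF c desirable_alongD(2)[OF f(1)] f(2)]
      by (intro desirable_alongI) (auto simp: gambles_def)
  qed
qed

text \<open>Some section of \<open>h\<close> lies in \<open>D n\<close>; the matching section of
  \<open>h'\<close> is 0 or in \<open>D n\<close>, so the sum has a section in \<open>D n\<close>
  and cannot cancel.\<close>

lemma desirable_along_add_nonzero:
  assumes "n \<in> N" "h \<in> desirable_along n" "h' \<in> desirable_along n" "h \<noteq> (\<lambda>_. 0)"
  shows "(\<lambda>x. h x + h' x) \<noteq> (\<lambda>_. 0)"
proof -
  obtain x where x: "x \<in> \<Omega>" "(\<lambda>z. h (x(n := z))) \<in> D n"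
    using desirable_along_nonzeroE assms by blast
  have "(\<lambda>z. h (x(n := z)) + h' (x(n := z))) \<in> D n"
    using desirable_alongD(2)[OF assms(3) x(1)]
  proof
    assume 0: "(\<lambda>z. h' (x(n := z))) = (\<lambda>_. 0)"
    show ?thesis using x(2) fun_cong[OF 0] by simp
  next
    assume "(\<lambda>z. h' (x(n := z))) \<in> D n"
    then show ?thesis by (rule convex_coneD(1)[OF convex_cone_D[OF assms(1)] x(2)])
  qed
  then show ?thesis by (rule section_nonzero[OF _ assms(1)])
qed

lemma partial_productI:
  assumes "q \<in> nonneg_gambles" "\<And>n. n \<in> R \<Longrightarrow> h n \<in> desirable_along n"
    and "q \<noteq> (\<lambda>_. 0) \<or> (\<exists>n\<in>R. h n \<noteq> (\<lambda>_. 0))"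
  shows "(\<lambda>x. q x + (\<Sum>n\<in>R. h n x)) \<in> partial_product R"
  using assms unfolding partial_product_def by blast

lemma partial_productE:
  assumes "f \<in> partial_product R"
  obtains q h where "q \<in> nonneg_gambles" "\<And>n. n \<in> R \<Longrightarrow> h n \<in> desirable_along n"
    "q \<noteq> (\<lambda>_. 0) \<or> (\<exists>n\<in>R. h n \<noteq> (\<lambda>_. 0))" "f = (\<lambda>x. q x + (\<Sum>n\<in>R. h n x))"
  using assms unfolding partial_product_def by blast

lemma partial_product_gambles: "partial_product R \<subseteq> gambles \<Omega>"
proof
  fix f assume "f \<in> partial_product R"
  then obtain q h where q: "q \<in> nonneg_gambles" and h: "\<And>n. n \<in> R \<Longrightarrow> h n \<in> desirable_along n"
    and f: "f = (\<lambda>x. q x + (\<Sum>n\<in>R. h n x))"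
    by (rule partial_productE) blast
  have "h n x = 0" if "n \<in> R" "x \<notin> \<Omega>" for n x
    using desirable_alongD(1)[OF h[OF that(1)]] that(2) unfolding gambles_def by blast
  moreover have "q x = 0" if "x \<notin> \<Omega>" for x
    using nonneg_gamblesD(1)[OF q] that unfolding gambles_def by blast
  ultimately show "f \<in> gambles \<Omega>" by (simp add: f gambles_def)
qed

lemma partial_product_mono:
  assumes "R \<subseteq> N"
  shows "partial_product R \<subseteq> partial_product N"
proof
  fix f assume "f \<in> partial_product R"
  then obtain q h where q: "q \<in> nonneg_gambles" and h: "\<And>n. n \<in> R \<Longrightarrow> h n \<in> desirable_along n"
    and nz: "q \<noteq> (\<lambda>_. 0) \<or> (\<exists>n\<in>R. h n \<noteq> (\<lambda>_. 0))" and f: "f = (\<lambda>x. q x + (\<Sum>n\<in>R. h n x))"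
    by (rule partial_productE) blast
  define h' where "h' n = (if n \<in> R then h n else (\<lambda>_. 0))" for n
  have "(\<lambda>x. q x + (\<Sum>n\<in>N. h' n x)) \<in> partial_product N"
    using q h nz assms zero_desirable_along by (intro partial_productI) (auto simp: h'_def)
  moreover have "(\<Sum>n\<in>N. h' n x) = (\<Sum>n\<in>R. h n x)" for x
    using assms finite_N by (intro sum.mono_neutral_cong_right) (auto simp: h'_def)
  ultimately show "f \<in> partial_product N" by (simp add: f)
qed

text \<open>Decompositions are added term by term. Non-triviality of the first one is inherited by
  the sum, as neither non-negative gambles nor gambles desirable along the same coordinate
  cancel.\<close>

lemma convex_cone_partial_product:
  assumes "R \<subseteq> N"
  shows "convex_cone (partial_product R)"
  unfolding convex_cone_def
proof (intro conjI ballI allI impI)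
  fix f f' assume ff: "f \<in> partial_product R" "f' \<in> partial_product R"
  from ff(1) obtain q h where q: "q \<in> nonneg_gambles" and h: "\<And>n. n \<in> R \<Longrightarrow> h n \<in> desirable_along n"
    and nz: "q \<noteq> (\<lambda>_. 0) \<or> (\<exists>n\<in>R. h n \<noteq> (\<lambda>_. 0))" and f: "f = (\<lambda>x. q x + (\<Sum>n\<in>R. h n x))"
    by (rule partial_productE) blast
  from ff(2) obtain q' h' where q': "q' \<in> nonneg_gambles" and h': "\<And>n. n \<in> R \<Longrightarrow> h' n \<in> desirable_along n"
    and f': "f' = (\<lambda>x. q' x + (\<Sum>n\<in>R. h' n x))"
    by (rule partial_productE) blast
  have "(\<lambda>x. (q x + q' x) + (\<Sum>n\<in>R. h n x + h' n x)) \<in> partial_product R"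
  proof (rule partial_productI)
    show "(\<lambda>x. q x + q' x) \<in> nonneg_gambles"
      using q q' by (auto simp: nonneg_gambles_def gambles_def)
    show "(\<lambda>x. h n x + h' n x) \<in> desirable_along n" if "n \<in> R" for n
      using that assms h h' convex_coneD(1)[OF convex_cone_desirable_along] by blast
    show "(\<lambda>x. q x + q' x) \<noteq> (\<lambda>_. 0) \<or> (\<exists>n\<in>R. (\<lambda>x. h n x + h' n x) \<noteq> (\<lambda>_. 0))"
      using nz
    proof
      assume "q \<noteq> (\<lambda>_. 0)"
      then obtain x where "q x \<noteq> 0" by auto
      then have "q x + q' x \<noteq> 0"
        using nonneg_gamblesD(2)[OF q, of x] nonneg_gamblesD(2)[OF q', of x] by linarith
      then show ?thesis by metis
    next
      assume "\<exists>n\<in>R. h n \<noteq> (\<lambda>_. 0)"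
      then show ?thesis using assms h h' desirable_along_add_nonzero by blast
    qed
  qed
  then show "(\<lambda>x. f x + f' x) \<in> partial_product R"
    by (simp add: f f' sum.distrib algebra_simps)
next
  fix f and c :: real assume f': "f \<in> partial_product R" and c: "c > 0"
  from f' obtain q h where q: "q \<in> nonneg_gambles" and h: "\<And>n. n \<in> R \<Longrightarrow> h n \<in> desirable_along n"
    and nz: "q \<noteq> (\<lambda>_. 0) \<or> (\<exists>n\<in>R. h n \<noteq> (\<lambda>_. 0))" and f: "f = (\<lambda>x. q x + (\<Sum>n\<in>R. h n x))"
    by (rule partial_productE) blast
  have "(\<lambda>x. c * q x + (\<Sum>n\<in>R. c * h n x)) \<in> partial_product R"
  proof (rule partial_productI)
    show "(\<lambda>x. c * q x) \<in> nonneg_gambles"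
      using q c by (auto simp: nonneg_gambles_def gambles_def)
    show "(\<lambda>x. c * h n x) \<in> desirable_along n" if "n \<in> R" for n
      using that assms h c convex_coneD(2)[OF convex_cone_desirable_along] by blast
    show "(\<lambda>x. c * q x) \<noteq> (\<lambda>_. 0) \<or> (\<exists>n\<in>R. (\<lambda>x. c * h n x) \<noteq> (\<lambda>_. 0))"
      using nz c by (auto simp: fun_eq_iff)
  qed
  then show "(\<lambda>x. c * f x) \<in> partial_product R"
    by (simp add: f sum_distrib_left algebra_simps)
qed

section \<open>Averaging out one coordinate\<close>

lemma indicator_in_D:
  assumes "n \<in> N" "z \<in> X n"
  shows "indicat_real {z} \<in> D n"
proof -
  have "indicat_real {z} \<noteq> (\<lambda>_. 0)" by (auto simp: fun_eq_iff indicator_def)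
  then have "indicat_real {z} \<in> pos_gambles (X n)"
    using assms(2) by (intro pos_gamblesI) (auto simp: gambles_def indicator_def)
  then show ?thesis using pos_D[OF assms(1)] by blast
qed

text \<open>Updates at \<open>m\<close> and \<open>n\<close> commute, so a section of the average
  along \<open>n\<close> is a positive combination of sections of \<open>h\<close> along
  \<open>n\<close>.\<close>

lemma average_desirable_along:
  assumes h: "h \<in> desirable_along n" and nm: "n \<in> N" "m \<in> N" "n \<noteq> m"
    and p: "\<And>z. z \<in> X m \<Longrightarrow> p z > 0"
  shows "average m p h \<in> desirable_along n"
    and "h \<noteq> (\<lambda>_. 0) \<Longrightarrow> average m p h \<noteq> (\<lambda>_. 0)"
proof -
  have c: "convex_cone (insert (\<lambda>_. 0) (D n))"
    using nm by (intro convex_cone_insert_zero convex_cone_D)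
  have sect: "(\<lambda>z. average m p h (x(n := z))) = (\<lambda>z. \<Sum>w\<in>X m. p w * h ((x(m := w))(n := z)))"
    if x: "x \<in> \<Omega>" for x
  proof
    fix z
    show "average m p h (x(n := z)) = (\<Sum>w\<in>X m. p w * h ((x(m := w))(n := z)))"
    proof (cases "z \<in> X n")
      case True
      then show ?thesis
        using x nm by (simp add: average_def upd_Omega fun_upd_twist[of m n])
    next
      case False
      then have "h ((x(m := w))(n := z)) = 0" if "w \<in> X m" for w
        using that x nm desirable_alongD(1)[OF h] by (simp add: gamble_upd upd_Omega)
      then show ?thesis using False x nm by (simp add: average_def upd_Omega)
    qed
  qed
  have mem: "(\<lambda>z. p w * h ((x(m := w))(n := z))) \<in> insert (\<lambda>_. 0) (D n)"
    if "x \<in> \<Omega>" "w \<in> X m" for x w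
    using that nm p by (intro convex_coneD(2)[OF c] desirable_alongD(2)[OF h]) (auto simp: upd_Omega)
  show "average m p h \<in> desirable_along n"
  proof (rule desirable_alongI)
    show "average m p h \<in> gambles \<Omega>" by (simp add: average_def gambles_def)
    fix x assume x: "x \<in> \<Omega>"
    show "(\<lambda>z. average m p h (x(n := z))) \<in> insert (\<lambda>_. 0) (D n)"
      unfolding sect[OF x] using mem[OF x] finite_X[OF nm(2)] by (intro convex_cone_sum[OF c]) auto
  qed
  assume "h \<noteq> (\<lambda>_. 0)"
  then obtain x where x: "x \<in> \<Omega>" "(\<lambda>z. h (x(n := z))) \<in> D n"
    using desirable_along_nonzeroE h by blast
  \<comment> \<open>The term with \<open>w = x m\<close> is a positive multiple of the section at
    \<open>x\<close> itself, which lies in \<open>D n\<close>.\<close>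
  have xm: "x m \<in> X m" using x nm by auto
  have "(\<lambda>z. \<Sum>w\<in>X m. p w * h ((x(m := w))(n := z))) \<in> D n"
  proof (rule sum_insert_zero_mem[OF convex_cone_D[OF nm(1)] finite_X[OF nm(2)] mem[OF x(1)] xm])
    show "(\<lambda>z. p (x m) * h ((x(m := x m))(n := z))) \<in> D n"
      using convex_coneD(2)[OF convex_cone_D[OF nm(1)] x(2) p[OF xm]] by simp
  qed
  then have "(\<lambda>z. average m p h (x(n := z))) \<in> D n" by (simp add: sect[OF x(1)])
  then show "average m p h \<noteq> (\<lambda>_. 0)" by (rule section_nonzero[OF _ nm(1)])
qed

lemma average_nonneg:
  assumes q: "q \<in> nonneg_gambles" and m: "m \<in> N" and p: "\<And>z. z \<in> X m \<Longrightarrow> p z > 0"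
  shows "average m p q \<in> nonneg_gambles"
    and "q \<noteq> (\<lambda>_. 0) \<Longrightarrow> \<exists>x. average m p q x > 0"
proof -
  have nn: "p z * q (x(m := z)) \<ge> 0" if "z \<in> X m" for x z
    using that p[of z] nonneg_gamblesD(2)[OF q] by simp
  then show "average m p q \<in> nonneg_gambles"
    by (auto simp: average_def nonneg_gambles_def gambles_def intro!: sum_nonneg)
  assume "q \<noteq> (\<lambda>_. 0)"
  then obtain x where "q x \<noteq> 0" by auto
  then have "q x > 0" using nonneg_gamblesD(2)[OF q, of x] by simp
  moreover have x: "x \<in> \<Omega>" using \<open>q x \<noteq> 0\<close> nonneg_gamblesD(1)[OF q] by (auto simp: gambles_def)
  then have xm: "x m \<in> X m" using m by auto
  ultimately have "0 < p (x m) * q (x(m := x m))" using p by simp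
  then have "(\<Sum>z\<in>X m. p z * q (x(m := z))) > 0"
    using nn xm finite_X[OF m] by (intro sum_pos2[of _ "x m"]) auto
  then show "\<exists>x. average m p q x > 0" using x by (auto simp: average_def)
qed

text \<open>The elimination step. The mass function \<open>p\<close> may depend on \<open>f\<close>:
  only the finitely many sections of its \<open>m\<close>-th summand need positive
  expectation.\<close>

lemma average_partial_product:
  assumes f: "f \<in> partial_product R" and R: "R \<subseteq> N" and m: "m \<in> R"
  obtains p where "\<And>z. z \<in> X m \<Longrightarrow> p z > 0" "(\<Sum>z\<in>X m. p z) = 1"
    "average m p f \<in> partial_product (R - {m})"
proof -
  have mN: "m \<in> N" using R m by auto
  obtain q h where q: "q \<in> nonneg_gambles" and h: "\<And>n. n \<in> R \<Longrightarrow> h n \<in> desirable_along n"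
    and nz: "q \<noteq> (\<lambda>_. 0) \<or> (\<exists>n\<in>R. h n \<noteq> (\<lambda>_. 0))" and f: "f = (\<lambda>x. q x + (\<Sum>n\<in>R. h n x))"
    using f by (rule partial_productE) blast
  define sec where "sec x = (\<lambda>z. h m (x(m := z)))" for x
  \<comment> \<open>The sections secure positive expectations; the indicators force
    \<open>p0\<close> to be positive at every point of \<open>X m\<close>.\<close>
  define A where "A = (sec ` \<Omega> - {\<lambda>_. 0}) \<union> (\<lambda>z. indicat_real {z}) ` X m"
  have "sec x \<in> insert (\<lambda>_. 0) (D m)" if "x \<in> \<Omega>" for x
    unfolding sec_def using that h m by (intro desirable_alongD(2)) auto
  then have AD: "A \<subseteq> D m" using indicator_in_D[OF mN] by (auto simp: A_def)
  have "\<exists>p. \<forall>a\<in>A. (\<Sum>z\<in>X m. p z * a z) > (0::real)"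
  proof (rule strictly_positive_functional[OF finite_X[OF mN] _ AD convex_cone_D[OF mN] zero_notin_D[OF mN]])
    show "finite A" using finite_Omega finite_X[OF mN] by (simp add: A_def)
    show "a z = 0" if "a \<in> A" "z \<notin> X m" for a z
      using that AD D_gambles[OF mN] by (auto simp: gambles_def)
  qed
  then obtain p0 where p0: "\<And>a. a \<in> A \<Longrightarrow> (\<Sum>z\<in>X m. p0 z * a z) > 0" by blast
  have p0_pos: "p0 z > 0" if "z \<in> X m" for z
    using p0[of "indicat_real {z}"] that finite_X[OF mN] by (auto simp: A_def)
  define s where "s = (\<Sum>z\<in>X m. p0 z)"
  have s: "s > 0" unfolding s_def using p0_pos finite_X[OF mN] X_ne[OF mN] by (intro sum_pos) auto
  \<comment> \<open>Total mass 1 makes averaging fix every gamble that does not depend on coordinate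
    \<open>m\<close>.\<close>
  define p where "p z = p0 z / s" for z
  have p_pos: "p z > 0" if "z \<in> X m" for z using p0_pos[OF that] s by (simp add: p_def)
  have p_sum: "(\<Sum>z\<in>X m. p z) = 1" using s by (simp add: p_def s_def flip: sum_divide_distrib)
  have p_sec: "(\<Sum>z\<in>X m. p z * sec x z) > 0" if "x \<in> \<Omega>" "sec x \<noteq> (\<lambda>_. 0)" for x
  proof -
    have "(\<Sum>z\<in>X m. p0 z * sec x z) > 0" using p0[of "sec x"] that by (auto simp: A_def)
    then show ?thesis using s by (simp add: p_def flip: sum_divide_distrib)
  qed
  have p_sec0: "(\<Sum>z\<in>X m. p z * sec x z) \<ge> 0" if "x \<in> \<Omega>" for x
    using p_sec[OF that] by (cases "sec x = (\<lambda>_. 0)") auto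
  have hm: "average m p (h m) x = (if x \<in> \<Omega> then \<Sum>z\<in>X m. p z * sec x z else 0)" for x
    by (simp add: average_def sec_def)
  \<comment> \<open>The averaged \<open>m\<close>-th summand is non-negative and is absorbed into
    the non-negative part.\<close>
  define q' where "q' = (\<lambda>x. average m p q x + average m p (h m) x)"
  have aq: "average m p q \<in> nonneg_gambles" by (rule average_nonneg(1)[OF q mN p_pos])
  have hm0: "average m p (h m) x \<ge> 0" for x using p_sec0 by (simp add: hm)
  have "(\<lambda>x. q' x + (\<Sum>n\<in>R - {m}. average m p (h n) x)) \<in> partial_product (R - {m})"
  proof (rule partial_productI)
    show "q' \<in> nonneg_gambles"
      using aq hm0 by (auto simp: q'_def nonneg_gambles_def gambles_def hm)
    show "average m p (h n) \<in> desirable_along n" if "n \<in> R - {m}" for n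
      using that R by (intro average_desirable_along(1) h mN p_pos) auto
    show "q' \<noteq> (\<lambda>_. 0) \<or> (\<exists>n\<in>R - {m}. average m p (h n) \<noteq> (\<lambda>_. 0))"
    proof -
      consider "q \<noteq> (\<lambda>_. 0)" | "h m \<noteq> (\<lambda>_. 0)" | n where "n \<in> R - {m}" "h n \<noteq> (\<lambda>_. 0)"
        using nz by blast
      then show ?thesis
      proof cases
        case 1
        then obtain x where "average m p q x > 0" 
          using average_nonneg(2)[where p = p, OF q mN] p_pos by blast
        then have "q' x > 0" using hm0[of x] by (simp add: q'_def)
        then show ?thesis by auto
      next
        case 2
        then obtain x where x: "x \<in> \<Omega>" "sec x \<in> D m"
          unfolding sec_def using desirable_along_nonzeroE h m by blast
        then have "sec x \<noteq> (\<lambda>_. 0)" using zero_notin_D[OF mN] by auto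
        then have "average m p (h m) x > 0" using p_sec x by (simp add: hm)
        then have "q' x > 0" using nonneg_gamblesD(2)[OF aq, of x] by (simp add: q'_def)
        then show ?thesis by auto
      next
        case 3
        then show ?thesis 
          using average_desirable_along(2)[where p = p, OF h _ mN] p_pos R by blast
      qed
    qed
  qed
  moreover have "average m p f = (\<lambda>x. q' x + (\<Sum>n\<in>R - {m}. average m p (h n) x))"
  proof
    fix x
    have "finite R" using R finite_N finite_subset by blast
    show "average m p f x = q' x + (\<Sum>n\<in>R - {m}. average m p (h n) x)"
    proof (cases "x \<in> \<Omega>")
      case True
      have "average m p f x = average m p q x + (\<Sum>z\<in>X m. \<Sum>n\<in>R. p z * h n (x(m := z)))"
        using True by (simp add: average_def f distrib_left sum.distrib sum_distrib_left)
      also have "(\<Sum>z\<in>X m. \<Sum>n\<in>R. p z * h n (x(m := z))) = (\<Sum>n\<in>R. average m p (h n) x)"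
        using True by (subst sum.swap) (simp add: average_def)
      also have "\<dots> = average m p (h m) x + (\<Sum>n\<in>R - {m}. average m p (h n) x)"
        using m \<open>finite R\<close> by (rule sum.remove[rotated])
      finally show ?thesis by (simp add: q'_def)
    qed (simp add: average_def q'_def)
  qed
  ultimately show thesis using that[OF p_pos p_sum] by simp
qed

section \<open>Reduction to the relevant coordinates, and coherence\<close>

lemma depends_onD:
  "depends_on Q f \<Longrightarrow> x \<in> \<Omega> \<Longrightarrow> y \<in> \<Omega> \<Longrightarrow> (\<And>i. i \<in> Q \<Longrightarrow> x i = y i) \<Longrightarrow> f x = f y"
  unfolding depends_on_def by blast

lemma depends_on_mono: "depends_on Q f \<Longrightarrow> Q \<subseteq> Q' \<Longrightarrow> depends_on Q' f"
  unfolding depends_on_def by blast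

lemma depends_on_upd:
  assumes "depends_on (N - {m}) f" "x \<in> \<Omega>" "m \<in> N" "z \<in> X m"
  shows "f (x(m := z)) = f x"
  using assms by (intro depends_onD[OF assms(1)]) (auto simp: upd_Omega)

text \<open>Averaging over a coordinate on which \<open>f\<close> does not depend leaves
  \<open>f\<close> unchanged but removes the summand for that coordinate. Induction does this for
  all of \<open>I\<close>.\<close>

lemma partial_product_reduce:
  assumes f: "f \<in> partial_product N" and I: "finite I" "I \<subseteq> N" "depends_on (N - I) f"
  shows "f \<in> partial_product (N - I)"
  using I
proof (induction I)
  case empty
  then show ?case using f by simp
next
  case (insert m I)
  then have fI: "f \<in> partial_product (N - I)"
    using depends_on_mono[of "N - insert m I" f "N - I"] by auto
  have m: "m \<in> N - I" "m \<in> N" using insert by auto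
  have dep: "depends_on (N - {m}) f"
    using depends_on_mono[of "N - insert m I" f "N - {m}"] insert.prems by auto
  obtain p where p: "(\<Sum>z\<in>X m. p z) = 1" "average m p f \<in> partial_product (N - I - {m})"
    using average_partial_product[OF fI _ m(1)] by blast
  have "average m p f x = f x" for x
  proof (cases "x \<in> \<Omega>")
    case True
    then show ?thesis
      using p(1) by (simp add: average_def depends_on_upd[OF dep _ m(2)] flip: sum_distrib_right)
  next
    case False
    then show ?thesis using fI partial_product_gambles by (auto simp: average_def gambles_def)
  qed
  then have "average m p f = f" by auto
  moreover have "N - I - {m} = N - insert m I" by auto
  ultimately show ?case using p(2) by simp
qed

text \<open>The zero gamble depends on no coordinate, so every summand can be removed. What remains
  would be a non-zero non-negative gamble equal to 0.\<close>

lemma zero_notin_partial_product: "(\<lambda>_. 0) \<notin> partial_product N"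
proof
  assume "(\<lambda>_. 0) \<in> partial_product N"
  then have "(\<lambda>_. 0) \<in> partial_product (N - N)"
    by (intro partial_product_reduce finite_N) (auto simp: depends_on_def)
  then show False by (elim partial_productE) auto
qed

lemma coherent_partial_product: "coherent \<Omega> (partial_product N)"
  unfolding coherent_iff
proof (intro conjI partial_product_gambles zero_notin_partial_product subsetI)
  show "convex_cone (partial_product N)" by (rule convex_cone_partial_product) simp
  fix f assume "f \<in> pos_gambles \<Omega>"
  then have "f \<in> nonneg_gambles" "f \<noteq> (\<lambda>_. 0)"
    by (auto simp: pos_gambles_def nonneg_gambles_def gambles_def)
  then have "(\<lambda>x. f x + (\<Sum>n\<in>N. (\<lambda>_. 0) x)) \<in> partial_product N"
    using zero_desirable_along by (intro partial_productI) auto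
  then show "f \<in> partial_product N" by simp
qed

section \<open>Conditioning and independence\<close>

text \<open>After reduction only summands along \<open>N - I\<close> remain. Slicing on
  \<open>I\<close> keeps each of their sections or replaces it by 0, so the form of the
  decomposition survives.\<close>

lemma slice_in_partial_product:
  assumes f: "f \<in> partial_product N" and I: "I \<subseteq> N" and x: "x \<in> Pi\<^sub>E I X"
    and dep: "depends_on (N - I) f"
  shows "slice I x f \<in> partial_product N"
proof -
  have "f \<in> partial_product (N - I)"
    using partial_product_reduce f I dep finite_subset[OF I finite_N] by blast
  then obtain q h where q: "q \<in> nonneg_gambles"
    and h: "\<And>n. n \<in> N - I \<Longrightarrow> h n \<in> desirable_along n"
    and feq: "f = (\<lambda>x. q x + (\<Sum>n\<in>N - I. h n x))"
    by (rule partial_productE) blast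
  have "slice I x g y = of_bool (\<forall>i\<in>I. y i = x i) * g y" for g y
    by (simp add: slice_def)
  then have eq: "slice I x f = (\<lambda>y. slice I x q y + (\<Sum>n\<in>N - I. slice I x (h n) y))"
    by (simp only: fun_eq_iff feq distrib_left sum_distrib_left simp_thms)
  have "slice I x f \<noteq> (\<lambda>_. 0)"
  proof -
    obtain y where y: "f y \<noteq> 0" using f zero_notin_partial_product by (metis ext)
    then have yO: "y \<in> \<Omega>" using f partial_product_gambles by (auto simp: gambles_def)
    \<comment> \<open>Moving the coordinates in \<open>I\<close> to \<open>x\<close> does not change
      the value of \<open>f\<close> and lands in the slice, so the slice is non-zero.\<close>
    define y' where "y' i = (if i \<in> I then x i else y i)" for i
    have "y' \<in> \<Omega>" using x yO I by (auto simp: y'_def PiE_iff extensional_def)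
    then have "f y' = f y" using dep yO by (intro depends_onD) (auto simp: y'_def)
    then have "slice I x f y' \<noteq> 0" using y by (simp add: slice_def y'_def)
    then show ?thesis by auto
  qed
  then have nz: "slice I x q \<noteq> (\<lambda>_. 0) \<or> (\<exists>n\<in>N - I. slice I x (h n) \<noteq> (\<lambda>_. 0))"
    unfolding eq by auto
  have "slice I x f \<in> partial_product (N - I)"
    unfolding eq
  proof (rule partial_productI[OF _ _ nz])
    show "slice I x q \<in> nonneg_gambles"
      using q by (auto simp: slice_def nonneg_gambles_def gambles_def)
    fix n assume n: "n \<in> N - I"
    show "slice I x (h n) \<in> desirable_along n"
    proof (rule desirable_alongI)
      show "slice I x (h n) \<in> gambles \<Omega>"
        using desirable_alongD(1)[OF h[OF n]] by (auto simp: slice_def gambles_def)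
      fix y assume y: "y \<in> \<Omega>"
      have "(\<lambda>z. slice I x (h n) (y(n := z))) =
        (if \<forall>i\<in>I. y i = x i then (\<lambda>z. h n (y(n := z))) else (\<lambda>_. 0))"
        using n by (auto simp: slice_def fun_eq_iff)
      then show "(\<lambda>z. slice I x (h n) (y(n := z))) \<in> insert (\<lambda>_. 0) (D n)"
        using desirable_alongD(2)[OF h[OF n] y] by auto
    qed
  qed
  then show ?thesis using partial_product_mono by blast
qed

text \<open>The converse direction removes one conditioned coordinate at a time. \<open>Pi\<close>
  rather than \<open>Pi\<^sub>E\<close> lets the same \<open>x\<close> serve while \<open>I\<close>
  shrinks in the induction.\<close>

lemma slice_cancel:
  assumes "slice I x f \<in> partial_product N" "finite I" "I \<subseteq> N" "x \<in> Pi I X"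
    and f: "f \<in> gambles \<Omega>" and "depends_on (N - I) f"
  shows "f \<in> partial_product N"
  using assms(2,3,1,4,6)
proof (induction I)
  case empty
  then show ?case by (simp add: slice_def)
next
  case (insert m I)
  have m: "m \<in> N" "x m \<in> X m" using insert.prems by auto
  let ?F = "slice I x f" and ?G = "slice (insert m I) x f"
  have dep: "depends_on (N - {m}) ?F"
    unfolding depends_on_def
  proof (intro ballI impI)
    fix y y' assume y: "y \<in> \<Omega>" "y' \<in> \<Omega>" "\<forall>i\<in>N - {m}. y i = y' i"
    then have "f y = f y'" using insert.prems(4) by (intro depends_onD) auto
    moreover have "y i = y' i" if "i \<in> I" for i using that y insert by auto
    ultimately show "?F y = ?F y'" by (simp add: slice_def)
  qed
  obtain p where p: "\<And>z. z \<in> X m \<Longrightarrow> p z > 0" "average m p ?G \<in> partial_product (N - {m})"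
    using average_partial_product[OF insert.prems(2) _ m(1)] by blast
  have G: "?G y = (if y m = x m then ?F y else 0)" for y by (auto simp: slice_def)
  have "average m p ?G y = p (x m) * ?F y" for y
  proof (cases "y \<in> \<Omega>")
    case True
    have "average m p ?G y = (\<Sum>z\<in>X m. if z = x m then p z * ?F (y(m := z)) else 0)"
      unfolding average_def G using True by (auto intro!: sum.cong)
    also have "\<dots> = p (x m) * ?F (y(m := x m))" using m finite_X by (simp add: sum.delta)
    also have "?F (y(m := x m)) = ?F y" by (rule depends_on_upd[OF dep True m])
    finally show ?thesis .
  next
    case False
    then show ?thesis using f by (simp add: average_def slice_def gambles_def)
  qed
  then have "average m p ?G = (\<lambda>y. p (x m) * ?F y)" by (rule ext)
  moreover have "average m p ?G \<in> partial_product N"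
    using p(2) partial_product_mono[of "N - {m}"] by blast
  \<comment> \<open>Only the value \<open>x m\<close> contributes to the average, which is therefore
    \<open>p (x m)\<close> times the slice on \<open>I\<close>; this positive factor is divided
    out.\<close>
  ultimately have "(\<lambda>y. inverse (p (x m)) * (p (x m) * ?F y)) \<in> partial_product N"
    using p(1)[OF m(2)] convex_coneD(2)[OF convex_cone_partial_product[OF order_refl]] by simp
  also have "(\<lambda>y. inverse (p (x m)) * (p (x m) * ?F y)) = ?F"
    using p(1)[OF m(2)] by (simp add: fun_eq_iff)
  finally have "?F \<in> partial_product N" .
  then show ?case
    using insert depends_on_mono[of "N - insert m I" f "N - I"] by auto
qed

lemma cyl_gamble: "cyl X Q N f \<in> gambles \<Omega>"
  by (simp add: cyl_def gambles_def)

lemma depends_on_cyl: "depends_on Q (cyl X Q N f)"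
  unfolding depends_on_def cyl_def by (auto intro!: arg_cong[of _ _ f] simp: restrict_def)

text \<open>Since \<open>Q\<close> avoids \<open>I\<close>, extending from \<open>Q\<close> to
  \<open>N - I\<close> and then to \<open>N\<close> is the direct extension to
  \<open>N\<close>.\<close>

lemma ind_mult_cyl:
  assumes "I \<subseteq> N" "Q \<subseteq> N" "I \<inter> Q = {}" "x \<in> Pi\<^sub>E I X"
  shows "ind_mult X N I x (cyl X Q (N - I) f) = slice I x (cyl X Q N f)"
proof
  fix y
  show "ind_mult X N I x (cyl X Q (N - I) f) y = slice I x (cyl X Q N f) y"
  proof (cases "y \<in> \<Omega>")
    case True
    have "restrict y I = x \<longleftrightarrow> (\<forall>i\<in>I. y i = x i)"
      using assms(4) by (auto simp: fun_eq_iff PiE_iff extensional_def restrict_def)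
    moreover have "restrict y (N - I) \<in> Pi\<^sub>E (N - I) X" using True by auto
    moreover have "(N - I) \<inter> Q = Q" using assms by auto
    ultimately show ?thesis
      using True by (simp add: ind_mult_def cyl_def slice_def indicator_def)
  qed (simp add: ind_mult_def cyl_def slice_def)
qed

lemma independent_partial_product: "independent N X (partial_product N)"
  unfolding independent_def
proof (intro allI impI ballI)
  fix I Q x assume *: "I \<subseteq> N" "Q \<subseteq> N" "I \<inter> Q = {}" and x: "x \<in> Pi\<^sub>E I X"
  have "slice I x (cyl X Q N f) \<in> partial_product N \<longleftrightarrow> cyl X Q N f \<in> partial_product N" for f
  proof -
    have dep: "depends_on (N - I) (cyl X Q N f)"
      using * by (intro depends_on_mono[OF depends_on_cyl]) auto
    show ?thesis
      using slice_in_partial_product[OF _ *(1) x dep] x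
        slice_cancel[OF _ finite_subset[OF *(1) finite_N] *(1) _ cyl_gamble dep]
      by (auto simp: PiE_def)
  qed
  moreover have "cyl X Q (N - I) f \<in> gambles (Pi\<^sub>E (N - I) X)" for f
    by (simp add: cyl_def gambles_def)
  ultimately
  show "marg X (N - I) Q (conditional X N I x (partial_product N)) = marg X N Q (partial_product N)"
    unfolding marg_def conditional_def by (simp add: ind_mult_cyl[OF * x])
qed

section \<open>Marginals\<close>

lemma marg_partial_product:
  assumes n: "n \<in> N"
  shows "marg X N {n} (partial_product N) = single X n ` D n"
proof (intro equalityI subsetI)
  fix f assume "f \<in> single X n ` D n"
  then obtain g where g: "g \<in> D n" "f = single X n g" by blast
  let ?F = "cyl X {n} N f"
  have F: "?F x = (if x \<in> \<Omega> then g (x n) else 0)" for x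
    using n by (auto simp: g cyl_def single_def PiE_iff)
  define h where "h m = (if m = n then ?F else (\<lambda>_. 0))" for m
  \<comment> \<open>Every section of the extension along \<open>n\<close> is \<open>g\<close>
    itself, so the extension is a single summand along \<open>n\<close>.\<close>
  have sec: "(\<lambda>z. ?F (x(n := z))) = g" if "x \<in> \<Omega>" for x
    using that n D_gambles[OF n] g(1) by (auto simp: F fun_eq_iff upd_Omega gambles_def)
  then have "?F \<in> desirable_along n" using cyl_gamble g(1) by (intro desirable_alongI) auto
  moreover have "?F \<noteq> (\<lambda>_. 0)"
  proof -
    obtain x where "x \<in> \<Omega>" using Omega_ne by blast
    then show ?thesis using sec[of x] g(1) by (intro section_nonzero[of _ x, OF _ n]) auto
  qed
  ultimately have "(\<lambda>x. (\<lambda>_. 0) x + (\<Sum>m\<in>N. h m x)) \<in> partial_product N"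
    using n by (intro partial_productI zero_nonneg) (auto simp: h_def zero_desirable_along)
  moreover have "(\<Sum>m\<in>N. h m x) = ?F x" for x
    using n finite_N by (simp add: h_def if_distrib[of "\<lambda>f. f x"] sum.delta)
  ultimately have "?F \<in> partial_product N" by simp
  then show "f \<in> marg X N {n} (partial_product N)"
    by (auto simp: marg_def g single_def gambles_def)
next
  fix f assume "f \<in> marg X N {n} (partial_product N)"
  then have f: "f \<in> gambles (Pi\<^sub>E {n} X)" and F: "cyl X {n} N f \<in> partial_product N"
    by (auto simp: marg_def)
  let ?F = "cyl X {n} N f"
  have nn: "N - (N - {n}) = {n}" using n by auto
  \<comment> \<open>Averaging over all coordinates other than \<open>n\<close> leaves only
    \<open>q\<close> and the summand along \<open>n\<close>.\<close>
  have "?F \<in> partial_product (N - (N - {n}))"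
    using F finite_N depends_on_cyl[of "{n}" f] by (intro partial_product_reduce) (auto simp: nn)
  then obtain q h where q: "q \<in> nonneg_gambles" and h: "h n \<in> desirable_along n"
    and Feq: "?F = (\<lambda>x. q x + h n x)"
    unfolding nn by (rule partial_productE) auto
  \<comment> \<open>Any base point will do: \<open>?F\<close> depends on coordinate \<open>n\<close>
    alone, so one section determines \<open>f\<close>.\<close>
  obtain x where x: "x \<in> \<Omega>" using Omega_ne by blast
  define g where "g z = ?F (x(n := z))" for z
  have g: "g = (\<lambda>z. q (x(n := z)) + h n (x(n := z)))" by (rule ext) (simp add: g_def Feq)
  have single: "f = single X n g"
  proof
    fix y
    show "f y = single X n g y"
    proof (cases "y \<in> Pi\<^sub>E {n} X")
      case True
      then have "restrict (x(n := y n)) {n} = y" "y n \<in> X n"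
        by (auto simp: fun_eq_iff PiE_iff extensional_def restrict_def)
      then show ?thesis using True x n by (simp add: single_def g_def cyl_def upd_Omega)
    next
      case False
      then show ?thesis using f by (simp add: single_def gambles_def)
    qed
  qed
  have "g \<noteq> (\<lambda>_. 0)"
  proof
    assume "g = (\<lambda>_. 0)"
    then have "?F = (\<lambda>_. 0)" by (auto simp: single single_def cyl_def)
    then show False using F zero_notin_partial_product by simp
  qed
  have qs: "(\<lambda>z. q (x(n := z))) \<in> insert (\<lambda>_. 0) (D n)"
  proof (cases "(\<lambda>z. q (x(n := z))) = (\<lambda>_. 0)")
    case False
    then have "(\<lambda>z. q (x(n := z))) \<in> pos_gambles (X n)"
      using gamble_upd[OF nonneg_gamblesD(1)[OF q] n _ x] nonneg_gamblesD(2)[OF q]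
      by (intro pos_gamblesI) (auto simp: gambles_def)
    then show ?thesis using pos_D[OF n] by blast
  qed simp
  have "g \<in> insert (\<lambda>_. 0) (D n)"
    unfolding g by (rule convex_coneD(1)[OF convex_cone_insert_zero[OF convex_cone_D[OF n]]
        qs desirable_alongD(2)[OF h x]])
  then show "f \<in> single X n ` D n" using \<open>g \<noteq> _\<close> single by auto
qed

section \<open>Identification with the tensor product\<close>

lemma ind_mult_single:
  assumes "n \<in> N"
  shows "ind_mult X N (N - {n}) x (single X n g) =
    (\<lambda>y. if y \<in> \<Omega> \<and> restrict y (N - {n}) = x then g (y n) else 0)"
proof -
  have "N - (N - {n}) = {n}" using assms by auto
  then show ?thesis
    using assms by (auto simp: fun_eq_iff ind_mult_def cyl_def single_def indicator_def PiE_iff)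
qed

text \<open>Each generator is a non-zero gamble desirable along its coordinate. Conversely, a
  summand along \<open>n\<close> is the finite sum, over the values of the other coordinates, of
  indicators times its sections.\<close>

lemma tensor_product_eq: "tensor_product N X D = partial_product N"
proof
  let ?G = "\<lambda>n. {ind_mult X N (N - {n}) x (single X n g) | x g. g \<in> D n \<and> x \<in> Pi\<^sub>E (N - {n}) X}"
  let ?T = "tensor_product N X D"
  have cone: "convex_cone (partial_product N)" by (rule convex_cone_partial_product) simp
  have along: "h \<in> partial_product N" if "h \<in> desirable_along n" "h \<noteq> (\<lambda>_. 0)" "n \<in> N" for h n
  proof -
    have "(\<lambda>x. (\<lambda>_. 0) x + (\<Sum>m\<in>{n}. (\<lambda>_. h) m x)) \<in> partial_product {n}"
      using that by (intro partial_productI zero_nonneg) auto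
    then show ?thesis using partial_product_mono[of "{n}"] that by auto
  qed
  have "?G n \<subseteq> partial_product N" if n: "n \<in> N" for n
  proof clarify
    fix x g assume g: "g \<in> D n" and x: "x \<in> Pi\<^sub>E (N - {n}) X"
    let ?h = "ind_mult X N (N - {n}) x (single X n g)"
    have sec: "(\<lambda>z. ?h (y(n := z))) = (if restrict y (N - {n}) = x then g else (\<lambda>_. 0))"
      if y: "y \<in> \<Omega>" for y
    proof -
      have "restrict (y(n := z)) (N - {n}) = restrict y (N - {n})" for z by (auto simp: restrict_def)
      then show ?thesis
        using y n g D_gambles[OF n] by (auto simp: ind_mult_single fun_eq_iff upd_Omega gambles_def)
    qed
    show "?h \<in> partial_product N"
    proof (rule along[OF _ _ n])
      show "?h \<in> desirable_along n"
        using n g sec by (intro desirable_alongI) (auto simp: ind_mult_single gambles_def)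
      obtain z where z: "z \<in> X n" using X_ne[OF n] by blast
      have "x(n := z) \<in> \<Omega>" using x z n by (auto simp: PiE_iff extensional_def)
      moreover have "restrict (x(n := z)) (N - {n}) = x"
        using x by (auto simp: fun_eq_iff PiE_iff extensional_def)
      ultimately show "?h \<noteq> (\<lambda>_. 0)"
        using sec[of "x(n := z)"] g by (intro section_nonzero[of _ "x(n := z)", OF _ n]) simp
    qed
  qed
  then have "(\<Union>n\<in>N. posi (?G n)) \<subseteq> partial_product N" using posi_least[OF cone] by blast
  then show "?T \<subseteq> partial_product N"
    unfolding tensor_product_def
    using coherent_partial_product by (intro posi_least[OF cone]) (auto simp: coherent_iff)
  \<comment> \<open>Sections, and with them whole summands, may vanish; 0 is adjoined for the
    summation and discarded at the end because \<open>f\<close> is non-zero.\<close>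
  let ?TZ = "insert (\<lambda>_. 0) ?T"
  have cone0: "convex_cone ?TZ"
    unfolding tensor_product_def by (intro convex_cone_insert_zero convex_cone_posi)
  have T: "pos_gambles \<Omega> \<union> (\<Union>n\<in>N. posi (?G n)) \<subseteq> ?T"
    unfolding tensor_product_def by (rule posi_increasing)
  have G: "?G n \<subseteq> ?T" if "n \<in> N" for n
    using T posi_increasing[of "?G n"] that by blast
  show "partial_product N \<subseteq> ?T"
  proof
    fix f assume f: "f \<in> partial_product N"
    then obtain q h where q: "q \<in> nonneg_gambles" and h: "\<And>n. n \<in> N \<Longrightarrow> h n \<in> desirable_along n"
      and feq: "f = (\<lambda>x. q x + (\<Sum>n\<in>N. h n x))"
      by (rule partial_productE) blast
    have "q \<in> ?TZ"
      using T pos_gamblesI[OF nonneg_gamblesD[OF q]] by blast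
    moreover have "h n \<in> ?TZ" if n: "n \<in> N" for n
    proof -
      let ?P = "Pi\<^sub>E (N - {n}) X"
      let ?g = "\<lambda>x z. h n (x(n := z))"
      have "ind_mult X N (N - {n}) x (single X n (?g x)) \<in> ?TZ" if x: "x \<in> ?P" for x
      proof -
        obtain z where z: "z \<in> X n" using X_ne[OF n] by blast
        have "x(n := z) \<in> \<Omega>" using x z n by (auto simp: PiE_iff extensional_def)
        from desirable_alongD(2)[OF h[OF n] this] have "?g x \<in> insert (\<lambda>_. 0) (D n)" by simp
        then show ?thesis
        proof
          assume "?g x = (\<lambda>_. 0)"
          then show ?thesis using n by (simp add: ind_mult_single fun_eq_iff)
        next
          assume "?g x \<in> D n"
          then show ?thesis using G[OF n] x by blast
        qed
      qed
      then have "(\<lambda>y. \<Sum>x\<in>?P. ind_mult X N (N - {n}) x (single X n (?g x)) y) \<in> ?TZ"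
        using finite_N finite_X by (intro convex_cone_sum[OF cone0] finite_PiE) auto
      also have "(\<lambda>y. \<Sum>x\<in>?P. ind_mult X N (N - {n}) x (single X n (?g x)) y) = h n"
      proof
        fix y
        show "(\<Sum>x\<in>?P. ind_mult X N (N - {n}) x (single X n (?g x)) y) = h n y"
        proof (cases "y \<in> \<Omega>")
          case True
          have r: "restrict y (N - {n}) \<in> ?P" using True by auto
          have u: "(restrict y (N - {n}))(n := y n) = y"
            using True n by (auto simp: fun_eq_iff PiE_iff extensional_def)
          have "(\<Sum>x\<in>?P. ind_mult X N (N - {n}) x (single X n (?g x)) y) =
              (\<Sum>x\<in>?P. if restrict y (N - {n}) = x then ?g x (y n) else 0)"
            using True n by (simp add: ind_mult_single)
          also have "\<dots> = ?g (restrict y (N - {n})) (y n)"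
            using r finite_N finite_X by (subst sum.delta') (auto intro!: finite_PiE)
          finally show ?thesis by (simp add: u)
        next
          case False
          then show ?thesis
            using n desirable_alongD(1)[OF h[OF n]] by (simp add: ind_mult_single gambles_def)
        qed
      qed
      finally show ?thesis .
    qed
    ultimately have "f \<in> ?TZ"
      unfolding feq using finite_N by (intro convex_coneD(1)[OF cone0] convex_cone_sum[OF cone0]) auto
    then show "f \<in> ?T" using f zero_notin_partial_product by auto
  qed
qed

lemma independent_product_tensor: "independent_product N X D (tensor_product N X D)"
  unfolding independent_product_def tensor_product_eq
  using coherent_partial_product independent_partial_product marg_partial_product by blast

end

section \<open>Intersections and the strong product\<close>

lemma marg_Inter: "F \<noteq> {} \<Longrightarrow> marg X S Q (\<Inter>F) = (\<Inter>E\<in>F. marg X S Q E)"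
  by (auto simp: marg_def)

lemma conditional_Inter: "F \<noteq> {} \<Longrightarrow> conditional X S I x (\<Inter>F) = (\<Inter>E\<in>F. conditional X S I x E)"
  by (auto simp: conditional_def)

lemma independent_Inter:
  assumes "F \<noteq> {}" "\<And>E. E \<in> F \<Longrightarrow> independent N X E"
  shows "independent N X (\<Inter>F)"
  unfolding independent_def
proof (intro allI impI ballI)
  fix I Q x assume *: "I \<subseteq> N" "Q \<subseteq> N" "I \<inter> Q = {}" "x \<in> Pi\<^sub>E I X"
  have "marg X (N - I) Q (conditional X N I x E) = marg X N Q E" if "E \<in> F" for E
    using assms(2)[OF that] * unfolding independent_def by blast
  then show "marg X (N - I) Q (conditional X N I x (\<Inter>F)) = marg X N Q (\<Inter>F)"
    using assms(1) by (simp add: conditional_Inter marg_Inter[of "conditional X N I x ` F"] marg_Inter)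
qed

text \<open>Injectivity allows the image under \<open>single X n\<close> to be exchanged with an
  intersection of maximal sets.\<close>

lemma single_inject:
  assumes "g \<in> gambles (X n)" "g' \<in> gambles (X n)" "single X n g = single X n g'"
  shows "g = g'"
proof
  fix z
  show "g z = g' z"
  proof (cases "z \<in> X n")
    case True
    then show ?thesis using fun_cong[OF assms(3), of "\<lambda>i\<in>{n}. z"] by (simp add: single_def)
  next
    case False
    then show ?thesis using assms by (simp add: gambles_def)
  qed
qed

theorem proposition27:
  fixes N :: "'i set" and X :: "'i \<Rightarrow> 'a set" and D :: "'i \<Rightarrow> ('a \<Rightarrow> real) set"
  assumes "finite N" and "N \<noteq> {}"
    and "\<And>n. n \<in> N \<Longrightarrow> finite (X n)" and "\<And>n. n \<in> N \<Longrightarrow> X n \<noteq> {}"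
    and "\<And>n. n \<in> N \<Longrightarrow> coherent (X n) (D n)"
  shows "independent_product N X D (strong_product N X D)"
proof -
  define \<M> where "\<M> = {M. \<forall>n\<in>N. M n \<in> maximal_supersets (X n) (D n)}"
  define F where "F = tensor_product N X ` \<M>"
  have strong: "strong_product N X D = \<Inter>F"
    by (auto simp: strong_product_def F_def \<M>_def)
  have coh: "coherent (X n) M" if "M \<in> maximal_supersets (X n) (D n)" for n M
    using that by (auto simp: maximal_supersets_def maximal_coherent_def)
  have prod: "independent_product N X M (tensor_product N X M)" if "M \<in> \<M>" for M
  proof -
    interpret gamble_product N X M
      using assms(1,3,4) coh that by unfold_locales (simp_all add: \<M>_def)
    show ?thesis by (rule independent_product_tensor)
  qed
  have "\<exists>M. M \<in> maximal_supersets (X n) (D n)" if "n \<in> N" for n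
    using maximal_supersets_nonempty[OF assms(5)[OF that]] by blast
  then have "\<exists>M. \<forall>n\<in>N. M n \<in> maximal_supersets (X n) (D n)" by (intro bchoice) blast
  then obtain M0 where M0: "M0 \<in> \<M>" unfolding \<M>_def by blast
  then have F: "F \<noteq> {}" by (auto simp: F_def)
  have marg: "marg X N {n} (\<Inter>F) = single X n ` D n" if n: "n \<in> N" for n
  proof -
    have "marg X N {n} (tensor_product N X M) = single X n ` M n" if "M \<in> \<M>" for M
      using prod[OF that] n by (simp add: independent_product_def)
    then have "marg X N {n} (\<Inter>F) = (\<Inter>M\<in>\<M>. single X n ` M n)"
      unfolding marg_Inter[OF F] by (simp add: F_def)
    \<comment> \<open>Only component \<open>n\<close> of a family matters here, and every maximal
      superset of \<open>D n\<close> occurs as such a component: \<open>M0\<close> supplies the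
      others.\<close>
    also have "\<dots> = (\<Inter>M\<in>maximal_supersets (X n) (D n). single X n ` M)"
    proof
      show "(\<Inter>M\<in>maximal_supersets (X n) (D n). single X n ` M) \<subseteq> (\<Inter>M\<in>\<M>. single X n ` M n)"
        using n by (auto simp: \<M>_def)
      have "(\<Inter>M\<in>\<M>. single X n ` M n) \<subseteq> single X n ` M"
        if "M \<in> maximal_supersets (X n) (D n)" for M
      proof -
        have "M0(n := M) \<in> \<M>" using M0 that by (auto simp: \<M>_def)
        then have "(\<Inter>M\<in>\<M>. single X n ` M n) \<subseteq> single X n ` (M0(n := M)) n"
          by (rule INT_lower)
        then show ?thesis by simp
      qed
      then show "(\<Inter>M\<in>\<M>. single X n ` M n) \<subseteq> (\<Inter>M\<in>maximal_supersets (X n) (D n). single X n ` M)"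
        by (intro INT_greatest)
    qed
    also have "\<dots> = single X n ` \<Inter>(maximal_supersets (X n) (D n))"
    proof -
      have "inj_on (single X n) (gambles (X n))"
        by (intro inj_onI) (rule single_inject)
      moreover have "M \<subseteq> gambles (X n)" if "M \<in> maximal_supersets (X n) (D n)" for M
        using coh[OF that] by (simp add: coherent_iff)
      moreover have "M0 n \<in> maximal_supersets (X n) (D n)" using M0 n by (simp add: \<M>_def)
      ultimately show ?thesis
        using image_INT[of "single X n" "gambles (X n)" "maximal_supersets (X n) (D n)" "\<lambda>M. M" "M0 n"]
        by simp
    qed
    also have "\<Inter>(maximal_supersets (X n) (D n)) = D n"
      by (rule Inter_maximal_supersets[OF assms(5)[OF n]])
    finally show ?thesis .
  qed
  show ?thesis
    unfolding independent_product_def strong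
  proof (intro conjI ballI marg)
    show "coherent (Pi\<^sub>E N X) (\<Inter>F)"
      using F prod by (intro coherent_Inter) (auto simp: F_def independent_product_def)
    show "independent N X (\<Inter>F)"
      using F prod by (intro independent_Inter) (auto simp: F_def independent_product_def)
  qed
qed

end
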